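(* Let $(X,d_X)$ be a compact metric space, $k\ge1$ an integer, $\mathbb{F}$ a field, and let $I$ be any interval in $\mathrm{barc}_k^{\mathrm{VR}}(X;\mathbb{F})$. Then $$\mathrm{length}(I)\le\mathrm{spread}(X),$$ and, if $I=(u,v]$ for some $0<u<v$, then $v\le\mathrm{spread}_1(X)$.
   Context: For an integer $N\ge1$, $\mathrm{spread}_N(X)$ is the infimum of the $r>0$ for which there is a nonempty subset $A\subseteq X$ of cardinality at most $N$ with $\mathrm{diam}(A)<r$ and $\sup_{x\in X}\inf_{a\in A}d_X(x,a)<r$; and $\mathrm{spread}(X):=\inf_N\mathrm{spread}_N(X)$. For $r>0$, $\mathrm{VR}_r(X)$ is the simplicial complex whose vertices are the points of $X$ and whose simplices are the nonempty finite subsets of $X$ of diameter strictly less than $r$. The persistence module $(\mathrm{H}_k(\mathrm{VR}_r(X);\mathbb{F}))_{r>0}$, with maps induced by inclusions, is for compact $X$ isomorphic to a direct sum of interval modules; $\mathrm{barc}_k^{\mathrm{VR}}(X;\mathbb{F})$ denotes the (unique) corresponding multiset of nonempty intervals. *)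

theory Defs
  imports "HOL-Analysis.Analysis" "HOL-Library.Function_Algebras" "HOL-Library.Set_Algebras"
begin

section \<open>Spread\<close>

text \<open>
  Values are extended reals: the infimum over the empty set, which arises if \<open>X\<close> is empty or
  unbounded or \<open>N = 0\<close>, is \<open>\<infinity>\<close>. Here \<open>spread_le N\<close> is the variant with at most \<open>N\<close> points.
\<close>

definition spread_le :: "nat \<Rightarrow> 'a::metric_space set \<Rightarrow> ereal" where
  "spread_le N X = Inf (ereal ` {r. 0 < r \<and>
     (\<exists>A. A \<subseteq> X \<and> A \<noteq> {} \<and> finite A \<and> card A \<le> N \<and>
          diameter A < r \<and> (SUP x\<in>X. ereal (infdist x A)) < ereal r)})"

definition spread :: "'a::metric_space set \<Rightarrow> ereal" where
  "spread X = (INF N\<in>{1..}. spread_le N X)"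


section \<open>Vietoris--Rips complexes\<close>

definition vietoris_rips :: "'a::metric_space set \<Rightarrow> real \<Rightarrow> 'a set set" where
  "vietoris_rips X r = {\<sigma>. \<sigma> \<noteq> {} \<and> finite \<sigma> \<and> \<sigma> \<subseteq> X \<and> diameter \<sigma> < r}"


section \<open>Simplicial chains with coefficients in a field\<close>

text \<open>
  A simplicial complex is given by its set of simplices. Every simplex is oriented by a linear
  order on the vertices that is fixed once and for all; it exists by the well-ordering theorem.
  Another order changes the basis of the chain groups by signs only, so it gives isomorphic
  homology, compatibly with inclusions of complexes.
\<close>

definition vertex_order :: "'a rel" where
  "vertex_order = (SOME r. linear_order r)"

text \<open>
  A chain is a finitely supported coefficient function on simplices; those of dimension \<open>n\<close>
  have \<open>n + 1\<close> vertices.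
\<close>

definition simplicial_chains :: "'a set set \<Rightarrow> nat \<Rightarrow> ('a set \<Rightarrow> 'f::field) set" where
  "simplicial_chains K n = {c. finite {\<sigma>. c \<sigma> \<noteq> 0} \<and>
     (\<forall>\<sigma>. c \<sigma> \<noteq> 0 \<longrightarrow> \<sigma> \<in> K \<and> finite \<sigma> \<and> card \<sigma> = n + 1)}"

text \<open>
  For \<open>\<sigma> = {v\<^sub>0 < \<dots> < v\<^sub>n}\<close> the exponent below is the index \<open>i\<close> with \<open>v = v\<^sub>i\<close>.
\<close>

definition face_sign :: "'a set \<Rightarrow> 'a \<Rightarrow> 'f::field" where
  "face_sign \<sigma> v = (-1) ^ card {w \<in> \<sigma>. w \<noteq> v \<and> (w, v) \<in> vertex_order}"

text \<open>
  \<open>\<partial>[v\<^sub>0,\<dots>,v\<^sub>n] = (\<Sum>i\<le>n. (-1)\<^sup>i [v\<^sub>0,\<dots>,v\<^sub>i\<^sub>-\<^sub>1,v\<^sub>i\<^sub>+\<^sub>1,\<dots>,v\<^sub>n])\<close>, extended linearly. The empty face is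
  discarded, so that the complex is not augmented and boundaries of 0-chains vanish.
\<close>

definition simplicial_boundary :: "('a set \<Rightarrow> 'f::field) \<Rightarrow> 'a set \<Rightarrow> 'f" where
  "simplicial_boundary c \<tau> =
     (if \<tau> = {} then 0
      else \<Sum>\<sigma> | c \<sigma> \<noteq> 0. c \<sigma> * (\<Sum>v | v \<in> \<sigma> \<and> \<sigma> - {v} = \<tau>. face_sign \<sigma> v))"

definition cycles :: "'a set set \<Rightarrow> nat \<Rightarrow> ('a set \<Rightarrow> 'f::field) set" where
  "cycles K n = {c \<in> simplicial_chains K n. simplicial_boundary c = 0}"

definition boundaries :: "'a set set \<Rightarrow> nat \<Rightarrow> ('a set \<Rightarrow> 'f::field) set" where
  "boundaries K n = simplicial_boundary ` simplicial_chains K (n + 1)"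


section \<open>Persistence modules indexed by the positive reals\<close>

text \<open>
  Vector spaces \<open>V\<^sub>r\<close> over \<open>'f\<close> and maps \<open>V\<^sub>r \<rightarrow> V\<^sub>s\<close> for \<open>r \<le> s\<close>. Only the data at parameters
  \<open>0 < r \<le> s\<close> and at elements of the carriers is meaningful.
\<close>

record ('f, 'v) pers_module =
  pm_carrier :: "real \<Rightarrow> 'v set"
  pm_zero :: "real \<Rightarrow> 'v"
  pm_add :: "real \<Rightarrow> 'v \<Rightarrow> 'v \<Rightarrow> 'v"
  pm_scale :: "real \<Rightarrow> 'f \<Rightarrow> 'v \<Rightarrow> 'v"
  pm_map :: "real \<Rightarrow> real \<Rightarrow> 'v \<Rightarrow> 'v"

definition pm_isomorphic :: "('f, 'v) pers_module \<Rightarrow> ('f, 'w) pers_module \<Rightarrow> bool" where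
  "pm_isomorphic V W \<longleftrightarrow> (\<exists>\<phi>. \<forall>r>0.
     bij_betw (\<phi> r) (pm_carrier V r) (pm_carrier W r) \<and>
     (\<forall>x\<in>pm_carrier V r. \<forall>y\<in>pm_carrier V r.
        \<phi> r (pm_add V r x y) = pm_add W r (\<phi> r x) (\<phi> r y)) \<and>
     (\<forall>a. \<forall>x\<in>pm_carrier V r. \<phi> r (pm_scale V r a x) = pm_scale W r a (\<phi> r x)) \<and>
     (\<forall>s\<ge>r. \<forall>x\<in>pm_carrier V r. \<phi> s (pm_map V r s x) = pm_map W r s (\<phi> r x)))"

definition interval_module :: "real set \<Rightarrow> ('f::field, 'f) pers_module" where
  "interval_module I =
    \<lparr> pm_carrier = (\<lambda>r. if r \<in> I then UNIV else {0}),
      pm_zero = (\<lambda>r. 0),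
      pm_add = (\<lambda>r. (+)),
      pm_scale = (\<lambda>r. (*)),
      pm_map = (\<lambda>r s x. if r \<in> I \<and> s \<in> I then x else 0) \<rparr>"

definition direct_sum_module :: "'j set \<Rightarrow> ('j \<Rightarrow> ('f, 'v) pers_module) \<Rightarrow> ('f, 'j \<Rightarrow> 'v) pers_module"
  where
  "direct_sum_module J V =
    \<lparr> pm_carrier = (\<lambda>r. {x \<in> (\<Pi>\<^sub>E j\<in>J. pm_carrier (V j) r). finite {j \<in> J. x j \<noteq> pm_zero (V j) r}}),
      pm_zero = (\<lambda>r. \<lambda>j\<in>J. pm_zero (V j) r),
      pm_add = (\<lambda>r x y. \<lambda>j\<in>J. pm_add (V j) r (x j) (y j)),
      pm_scale = (\<lambda>r a x. \<lambda>j\<in>J. pm_scale (V j) r a (x j)),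
      pm_map = (\<lambda>r s x. \<lambda>j\<in>J. pm_map (V j) r s (x j)) \<rparr>"

text \<open>
  A barcode is a multiset of nonempty intervals in \<open>(0, \<infinity>)\<close>. It may be infinite, so it is
  represented by an indexed family; an interval of multiplicity \<open>m\<close> occurs at \<open>m\<close> indices.
\<close>

definition is_barcode :: "('f::field, 'v) pers_module \<Rightarrow> 'j set \<Rightarrow> ('j \<Rightarrow> real set) \<Rightarrow> bool" where
  "is_barcode V J I \<longleftrightarrow>
     (\<forall>j\<in>J. is_interval (I j) \<and> I j \<noteq> {} \<and> I j \<subseteq> {0<..}) \<and>
     pm_isomorphic V (direct_sum_module J (\<lambda>j. interval_module (I j)))"

definition interval_length :: "real set \<Rightarrow> ereal" where
  "interval_length I = (SUP x\<in>I. ereal x) - (INF x\<in>I. ereal x)"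


section \<open>Persistent homology\<close>

text \<open>
  Homology classes are cosets \<open>z +o B\<^sub>r\<close>, where \<open>Z\<^sub>r\<close> and \<open>B\<^sub>r\<close> are the cycles and boundaries of
  \<open>K r\<close>. Adding a subspace to a set of chains passes to cosets modulo it: \<open>a (z +o B\<^sub>r) + B\<^sub>r\<close> is
  the coset of \<open>a z\<close> (also for \<open>a = 0\<close>), and for \<open>B\<^sub>r \<subseteq> B\<^sub>s\<close> the map induced by the inclusion
  \<open>K r \<subseteq> K s\<close> sends \<open>C = z +o B\<^sub>r\<close> to \<open>C + B\<^sub>s = z +o B\<^sub>s\<close>.
\<close>

definition persistent_homology ::
  "(real \<Rightarrow> 'a set set) \<Rightarrow> nat \<Rightarrow> ('f::field, ('a set \<Rightarrow> 'f) set) pers_module" where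
  "persistent_homology K n =
    \<lparr> pm_carrier = (\<lambda>r. {z +o boundaries (K r) n | z. z \<in> cycles (K r) n}),
      pm_zero = (\<lambda>r. boundaries (K r) n),
      pm_add = (\<lambda>r C D. C + D),
      pm_scale = (\<lambda>r a C. (\<lambda>z \<sigma>. a * z \<sigma>) ` C + boundaries (K r) n),
      pm_map = (\<lambda>r s C. C + boundaries (K s) n) \<rparr>"

definition vr_homology ::
  "'a::metric_space set \<Rightarrow> nat \<Rightarrow> ('f::field, ('a set \<Rightarrow> 'f) set) pers_module" where
  "vr_homology X n = persistent_homology (vietoris_rips X) n"

end

theory Submission
  imports Defs
begin

text \<open>
  Let \<open>A\<close> be a finite set with \<open>diameter A < r\<close> and choose \<open>f x \<in> A\<close> with \<open>dist x (f x) < r\<close>, where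
  \<open>f\<close> is the identity on \<open>A\<close>. If \<open>\<sigma>\<close> has diameter less than \<open>s\<close>, then \<open>\<sigma> \<union> f ` \<sigma>\<close> has diameter less
  than \<open>s + r\<close>. Hence the vertices outside \<open>A\<close> of a cycle of the complex at scale \<open>s\<close> can be pushed
  into \<open>A\<close> one at a time without changing its homology class at scale \<open>s + r\<close>; the resulting cycle
  bounds because all finite subsets of \<open>A\<close> are simplices. So \<open>H\<^sub>k\<close> at scale \<open>s\<close> maps to zero at scale
  \<open>s + r\<close>, and no bar contains both. For \<open>A = {a}\<close> the complex at any scale from \<open>r\<close> on is a cone
  with apex \<open>a\<close>.
\<close>

section \<open>Augmented boundary and cones\<close>

lemma linear_order_vertex_order: "linear_order vertex_order"
proof -
  obtain r :: "'a rel" where "well_order_on UNIV r"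
    using well_order_on by blast
  then have "linear_order r"
    by (simp add: well_order_on_def)
  then show ?thesis
    unfolding vertex_order_def by (rule someI)
qed

lemma face_sign_square: "face_sign \<sigma> v * face_sign \<sigma> v = (1 :: 'f::field)"
  by (simp add: face_sign_def flip: power_mult_distrib)

lemma face_sign_insert:
  assumes "finite \<sigma>" "a \<notin> \<sigma>" "a \<noteq> v"
  shows "(face_sign (insert a \<sigma>) v :: 'f::field)
    = (if (a, v) \<in> vertex_order then - face_sign \<sigma> v else face_sign \<sigma> v)"
proof -
  have "{w \<in> insert a \<sigma>. w \<noteq> v \<and> (w, v) \<in> vertex_order} =
    (if (a, v) \<in> vertex_order then insert a {w \<in> \<sigma>. w \<noteq> v \<and> (w, v) \<in> vertex_order}
     else {w \<in> \<sigma>. w \<noteq> v \<and> (w, v) \<in> vertex_order})"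
    using assms by auto
  then show ?thesis
    using assms by (simp add: face_sign_def)
qed

text \<open>Exactly one of \<open>a\<close> and \<open>v\<close> precedes the other. Inserting the
  smaller raises the index of the larger by one, while inserting the larger leaves the index of the
  smaller alone, so exactly one of the two signs flips.\<close>

lemma face_sign_swap:
  assumes "finite \<rho>" "a \<notin> \<rho>" "v \<notin> \<rho>" "a \<noteq> v"
  shows "(face_sign (insert v (insert a \<rho>)) v * face_sign (insert v (insert a \<rho>)) a :: 'f::field)
    = - (face_sign (insert a \<rho>) a * face_sign (insert v \<rho>) v)"
proof -
  have "((a, v) \<in> vertex_order) \<noteq> ((v, a) \<in> vertex_order)"
    using linear_order_vertex_order[where 'a = 'a] \<open>a \<noteq> v\<close>
    unfolding linear_order_on_def partial_order_on_def
    by (metis UNIV_I antisymD total_on_def)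
  moreover have "(face_sign (insert v (insert a \<rho>)) a :: 'f)
      = (if (v, a) \<in> vertex_order then - face_sign (insert a \<rho>) a else face_sign (insert a \<rho>) a)"
    using assms by (intro face_sign_insert) auto
  moreover have "(face_sign (insert v (insert a \<rho>)) v :: 'f)
      = (if (a, v) \<in> vertex_order then - face_sign (insert v \<rho>) v else face_sign (insert v \<rho>) v)"
    using assms face_sign_insert[of "insert v \<rho>" a v] by (auto simp: insert_commute)
  ultimately show ?thesis
    by auto
qed

text \<open>Neither a complex nor a dimension is prescribed and \<open>{}\<close> counts as a
  simplex, so boundaries and cones can be formed freely.\<close>

definition finite_chain :: "('a set \<Rightarrow> 'f::field) \<Rightarrow> bool" where
  "finite_chain c \<longleftrightarrow> finite {\<sigma>. c \<sigma> \<noteq> 0} \<and> (\<forall>\<sigma>. c \<sigma> \<noteq> 0 \<longrightarrow> finite \<sigma>)"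

text \<open>The boundary of the augmented complex, as a sum over the simplices having
  \<open>\<tau>\<close> as a facet. Its value at \<open>{}\<close> is the augmentation, without
  which the cone formula would fail for 0-chains.\<close>

definition augmented_boundary :: "('a set \<Rightarrow> 'f::field) \<Rightarrow> 'a set \<Rightarrow> 'f" where
  "augmented_boundary c \<tau> =
     (\<Sum>v | v \<notin> \<tau> \<and> c (insert v \<tau>) \<noteq> 0. face_sign (insert v \<tau>) v * c (insert v \<tau>))"

text \<open>The join with apex \<open>a\<close>: the sign moves \<open>a\<close> to the front of the
  orientation. Simplices of \<open>c\<close> that already contain \<open>a\<close> contribute
  nothing.\<close>

definition cone_chain :: "'a \<Rightarrow> ('a set \<Rightarrow> 'f::field) \<Rightarrow> 'a set \<Rightarrow> 'f" where
  "cone_chain a c \<tau> = (if a \<in> \<tau> then face_sign \<tau> a * c (\<tau> - {a}) else 0)"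

definition chain_vertices :: "('a set \<Rightarrow> 'f::field) \<Rightarrow> 'a set" where
  "chain_vertices c = \<Union> {\<sigma>. c \<sigma> \<noteq> 0}"

section \<open>Finiteness and linearity\<close>

lemma finite_chain_vertices: "finite_chain c \<Longrightarrow> finite (chain_vertices c)"
  by (auto simp: finite_chain_def chain_vertices_def)

lemma finite_chain_zero_infinite: "finite_chain c \<Longrightarrow> infinite \<sigma> \<Longrightarrow> c \<sigma> = 0"
  by (auto simp: finite_chain_def)

lemma finite_chainI:
  assumes "finite V" "\<And>\<sigma>. c \<sigma> \<noteq> 0 \<Longrightarrow> \<sigma> \<subseteq> V"
  shows "finite_chain c"
proof -
  have "{\<sigma>. c \<sigma> \<noteq> 0} \<subseteq> Pow V"
    using assms by auto
  then show ?thesis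
    unfolding finite_chain_def using assms finite_subset by (metis finite_Pow_iff)
qed

lemma subset_chain_vertices: "c \<sigma> \<noteq> 0 \<Longrightarrow> \<sigma> \<subseteq> chain_vertices c"
  by (auto simp: chain_vertices_def)

lemma add_nonzero: "(c + d) \<sigma> \<noteq> 0 \<Longrightarrow> c \<sigma> \<noteq> 0 \<or> d \<sigma> \<noteq> (0 :: 'f::field)"
  by auto

lemma finite_chain_add:
  assumes "finite_chain c" "finite_chain d" shows "finite_chain (c + d)"
proof (rule finite_chainI)
  show "finite (chain_vertices c \<union> chain_vertices d)"
    using assms by (simp add: finite_chain_vertices)
  fix \<sigma> assume "(c + d) \<sigma> \<noteq> 0"
  then show "\<sigma> \<subseteq> chain_vertices c \<union> chain_vertices d"
    using add_nonzero[of c d \<sigma>] subset_chain_vertices[of c \<sigma>] subset_chain_vertices[of d \<sigma>]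
    by auto
qed

lemma finite_chain_uminus: "finite_chain c \<Longrightarrow> finite_chain (- c)"
  by (simp add: finite_chain_def)

lemma finite_chain_diff: "finite_chain c \<Longrightarrow> finite_chain d \<Longrightarrow> finite_chain (c - d)"
  using finite_chain_add[of c "- d"] finite_chain_uminus[of d] by simp

lemma augmented_boundary_nonzero:
  assumes "augmented_boundary c \<tau> \<noteq> 0"
  obtains v where "v \<notin> \<tau>" "c (insert v \<tau>) \<noteq> 0"
proof -
  obtain v where "v \<in> {v. v \<notin> \<tau> \<and> c (insert v \<tau>) \<noteq> 0}"
    using assms unfolding augmented_boundary_def by (meson sum.not_neutral_contains_not_neutral)
  then show thesis
    using that by blast
qed

lemma cone_nonzero:
  "cone_chain a c \<tau> \<noteq> 0 \<Longrightarrow> a \<in> \<tau> \<and> c (\<tau> - {a}) \<noteq> 0"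
  by (auto simp: cone_chain_def split: if_splits)

lemma finite_chain_augmented_boundary:
  assumes "finite_chain c" shows "finite_chain (augmented_boundary c)"
proof (rule finite_chainI[OF finite_chain_vertices[OF assms]])
  fix \<tau> assume "augmented_boundary c \<tau> \<noteq> 0"
  then show "\<tau> \<subseteq> chain_vertices c"
    using subset_chain_vertices augmented_boundary_nonzero by (metis insert_subset)
qed

lemma finite_chain_cone:
  assumes "finite_chain c" shows "finite_chain (cone_chain a c)"
proof (rule finite_chainI)
  show "finite (insert a (chain_vertices c))"
    using assms by (simp add: finite_chain_vertices)
  fix \<tau> assume "cone_chain a c \<tau> \<noteq> 0"
  then show "\<tau> \<subseteq> insert a (chain_vertices c)"
    using subset_chain_vertices cone_nonzero by (metis subset_insert_iff)
qed

text \<open>A fixed \<open>V\<close> replaces the index set that depends on \<open>c\<close>, so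
  that sums for different chains can be compared term by term.\<close>

lemma augmented_boundary_eq_sum:
  assumes "finite V" "chain_vertices c \<subseteq> V"
  shows "augmented_boundary c \<tau> = (\<Sum>v\<in>V - \<tau>. face_sign (insert v \<tau>) v * c (insert v \<tau>))"
  unfolding augmented_boundary_def
proof (rule sum.mono_neutral_left)
  show "{v. v \<notin> \<tau> \<and> c (insert v \<tau>) \<noteq> 0} \<subseteq> V - \<tau>"
    using assms(2) subset_chain_vertices by blast
qed (use assms in auto)

lemma augmented_boundary_add:
  assumes "finite_chain c" "finite_chain d"
  shows "augmented_boundary (c + d) = augmented_boundary c + augmented_boundary d"
proof
  fix \<tau>
  let ?V = "chain_vertices c \<union> chain_vertices d"
  have "\<sigma> \<subseteq> ?V" if "(c + d) \<sigma> \<noteq> 0" for \<sigma>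
    using add_nonzero[OF that] subset_chain_vertices[of c \<sigma>] subset_chain_vertices[of d \<sigma>] by auto
  then have V: "finite ?V" "chain_vertices (c + d) \<subseteq> ?V"
    using assms by (auto simp: finite_chain_vertices chain_vertices_def[of "c + d"])
  show "augmented_boundary (c + d) \<tau> = (augmented_boundary c + augmented_boundary d) \<tau>"
    using V by (simp add: augmented_boundary_eq_sum[of ?V] distrib_left sum.distrib)
qed

lemma augmented_boundary_uminus: "augmented_boundary (- c) = - augmented_boundary c"
  by (simp add: fun_eq_iff augmented_boundary_def sum_negf)

lemma augmented_boundary_diff:
  assumes "finite_chain c" "finite_chain d"
  shows "augmented_boundary (c - d) = augmented_boundary c - augmented_boundary d"
  using augmented_boundary_add[OF assms(1) finite_chain_uminus[OF assms(2)]]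
  by (simp add: augmented_boundary_uminus)

lemma augmented_boundary_zero: "augmented_boundary 0 = 0"
  by (simp add: fun_eq_iff augmented_boundary_def)

lemma cone_zero: "cone_chain a 0 = 0"
  by (simp add: fun_eq_iff cone_chain_def)

text \<open>The cone is a contracting homotopy of the augmented complex. If \<open>a\<close> is not
  in \<open>\<tau>\<close>, only \<open>insert a \<tau>\<close> contributes and its sign squares to
  1. If \<open>a\<close> is in \<open>\<tau>\<close>, \<open>face_sign_swap\<close> turns the sum
  into minus the cone of the boundary, except for the missing term \<open>v = a\<close>, which
  accounts for \<open>c \<tau>\<close>.\<close>

lemma augmented_boundary_cone:
  assumes c: "finite_chain c"
  shows "augmented_boundary (cone_chain a c) = c - cone_chain a (augmented_boundary c)"
proof
  fix \<tau>
  define V where "V = insert a (chain_vertices c)"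
  have V: "finite V" "chain_vertices c \<subseteq> V" "a \<in> V"
    using c by (auto simp: V_def finite_chain_vertices)
  have "\<sigma> \<subseteq> V" if "cone_chain a c \<sigma> \<noteq> 0" for \<sigma>
    using cone_nonzero[OF that] subset_chain_vertices[of c "\<sigma> - {a}"] by (auto simp: V_def)
  then have Vc: "chain_vertices (cone_chain a c) \<subseteq> V"
    by (auto simp: chain_vertices_def)
  have eq: "augmented_boundary (cone_chain a c) \<tau>
      = (\<Sum>v\<in>V - \<tau>. face_sign (insert v \<tau>) v * cone_chain a c (insert v \<tau>))"
    by (rule augmented_boundary_eq_sum[OF V(1) Vc])
  show "augmented_boundary (cone_chain a c) \<tau> = (c - cone_chain a (augmented_boundary c)) \<tau>"
  proof (cases "a \<in> \<tau>")
    case False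
    have "(\<Sum>v\<in>V - \<tau>. face_sign (insert v \<tau>) v * cone_chain a c (insert v \<tau>))
        = (\<Sum>v\<in>{a}. face_sign (insert v \<tau>) v * cone_chain a c (insert v \<tau>))"
      using V False by (intro sum.mono_neutral_right) (auto simp: cone_chain_def)
    also have "\<dots> = c \<tau>"
      using False by (simp add: cone_chain_def face_sign_square flip: mult.assoc)
    finally show ?thesis
      using False eq by (simp add: cone_chain_def)
  next
    case True
    define \<rho> where "\<rho> = \<tau> - {a}"
    have \<tau>: "\<tau> = insert a \<rho>" and a\<rho>: "a \<notin> \<rho>"
      using True by (auto simp: \<rho>_def)
    show ?thesis
    \<comment> \<open>The sign rule holds for finite simplices; for infinite \<open>\<tau>\<close>
      every coefficient involved vanishes.\<close>
    proof (cases "finite \<tau>")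
      case False
      then have "augmented_boundary (cone_chain a c) \<tau> = 0" "augmented_boundary c \<rho> = 0" "c \<tau> = 0"
        using finite_chain_zero_infinite c finite_chain_augmented_boundary finite_chain_cone
        by (metis \<tau> finite_insert)+
      then show ?thesis
        by (simp add: cone_chain_def \<rho>_def)
    next
      case fin: True
      have "(\<Sum>v\<in>V - \<tau>. face_sign (insert v \<tau>) v * cone_chain a c (insert v \<tau>))
          = (\<Sum>v\<in>V - \<tau>. - (face_sign \<tau> a * (face_sign (insert v \<rho>) v * c (insert v \<rho>))))"
      proof (rule sum.cong)
        fix v assume v: "v \<in> V - \<tau>"
        then have "insert v \<tau> - {a} = insert v \<rho>" "v \<noteq> a" "v \<notin> \<rho>"
          using \<tau> a\<rho> by auto
        moreover have "(face_sign (insert v \<tau>) v * face_sign (insert v \<tau>) a :: 'b)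
            = - (face_sign \<tau> a * face_sign (insert v \<rho>) v)"
          unfolding \<tau> using fin \<tau> a\<rho> \<open>v \<noteq> a\<close> \<open>v \<notin> \<rho>\<close> by (intro face_sign_swap) auto
        ultimately show "face_sign (insert v \<tau>) v * cone_chain a c (insert v \<tau>)
            = - (face_sign \<tau> a * (face_sign (insert v \<rho>) v * c (insert v \<rho>)))"
          using True by (simp add: cone_chain_def flip: mult.assoc)
      qed simp
      also have "\<dots> = - (face_sign \<tau> a * (\<Sum>v\<in>V - \<tau>. face_sign (insert v \<rho>) v * c (insert v \<rho>)))"
        by (simp add: sum_negf sum_distrib_left)
      finally have 1: "augmented_boundary (cone_chain a c) \<tau>
          = - (face_sign \<tau> a * (\<Sum>v\<in>V - \<tau>. face_sign (insert v \<rho>) v * c (insert v \<rho>)))"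
        using eq by simp
      have "V - \<rho> = insert a (V - \<tau>)"
        using \<tau> a\<rho> V by auto
      then have "augmented_boundary c \<rho> = face_sign \<tau> a * c \<tau>
          + (\<Sum>v\<in>V - \<tau>. face_sign (insert v \<rho>) v * c (insert v \<rho>))"
        using V True by (simp add: augmented_boundary_eq_sum[OF V(1,2)] flip: \<tau>)
      then have "cone_chain a (augmented_boundary c) \<tau> = c \<tau> - augmented_boundary (cone_chain a c) \<tau>"
        using True by (simp add: 1 cone_chain_def \<rho>_def distrib_left face_sign_square flip: mult.assoc)
      then show ?thesis
        by simp
    qed
  qed
qed

text \<open>
  A chain all of whose simplices contain \<open>a\<close> is a cone with apex \<open>a\<close>, and the cone formula turns the
  double boundary of a cone into the cone of a double boundary, which involves fewer vertices.
\<close>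

lemma augmented_boundary_boundary:
  assumes "finite_chain c"
  shows "augmented_boundary (augmented_boundary c) = 0"
proof -
  have "finite V \<Longrightarrow> finite_chain c \<Longrightarrow> chain_vertices c \<subseteq> V
      \<Longrightarrow> augmented_boundary (augmented_boundary c) = 0" for V and c :: "'a set \<Rightarrow> 'b"
  proof (induction V arbitrary: c rule: finite_induct)
    case empty
    \<comment> \<open>Only the empty simplex is left, and it has no facets.\<close>
    have "augmented_boundary c = 0"
      by (simp add: fun_eq_iff augmented_boundary_eq_sum[OF finite.emptyI empty(2)])
    then show ?case
      by (metis augmented_boundary_zero)
  next
    case (insert a V)
    \<comment> \<open>\<open>d\<close> is the link of \<open>a\<close> in \<open>c\<close>, signed
      so that its cone restores the simplices through \<open>a\<close>; \<open>e\<close> collects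
      the others. Neither involves \<open>a\<close>, so the induction hypothesis applies to
      both.\<close>
    define d where "d \<rho> = (if a \<in> \<rho> then 0 else face_sign (insert a \<rho>) a * c (insert a \<rho>))" for \<rho>
    define e where "e \<sigma> = (if a \<in> \<sigma> then 0 else c \<sigma>)" for \<sigma>
    have "cone_chain a d \<sigma> + e \<sigma> = c \<sigma>" for \<sigma>
      by (simp add: cone_chain_def d_def e_def insert_absorb face_sign_square flip: mult.assoc)
    then have c: "c = cone_chain a d + e"
      by (simp add: fun_eq_iff)
    have d_sub: "\<sigma> \<subseteq> V" if "d \<sigma> \<noteq> 0" for \<sigma>
      using that insert.prems subset_chain_vertices[of c "insert a \<sigma>"]
      by (auto simp: d_def split: if_splits)
    have e_sub: "\<sigma> \<subseteq> V" if "e \<sigma> \<noteq> 0" for \<sigma>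
      using that insert.prems subset_chain_vertices[of c \<sigma>]
      by (auto simp: e_def split: if_splits)
    have d: "finite_chain d" and e: "finite_chain e"
      using d_sub e_sub insert.hyps by (auto intro: finite_chainI)
    have dd: "augmented_boundary (augmented_boundary d) = 0"
      using d d_sub by (intro insert.IH) (auto simp: chain_vertices_def)
    have ee: "augmented_boundary (augmented_boundary e) = 0"
      using e e_sub by (intro insert.IH) (auto simp: chain_vertices_def)
    have "augmented_boundary (augmented_boundary (cone_chain a d)) = 0"
      using d dd by (simp add: augmented_boundary_cone augmented_boundary_diff
          finite_chain_augmented_boundary finite_chain_cone cone_zero)
    with ee show ?case
      unfolding c augmented_boundary_add[OF finite_chain_cone[OF d] e]
        augmented_boundary_add[OF finite_chain_augmented_boundary[OF finite_chain_cone[OF d]]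
          finite_chain_augmented_boundary[OF e]]
      by simp
  qed
  from this[OF finite_chain_vertices[OF assms] assms subset_refl] show ?thesis .
qed


section \<open>Simplicial chains\<close>

lemma simplicial_chains_finite_chain: "c \<in> simplicial_chains K n \<Longrightarrow> finite_chain c"
  by (auto simp: simplicial_chains_def finite_chain_def)

lemma simplicial_chainsI:
  assumes "finite_chain c" "\<And>\<sigma>. c \<sigma> \<noteq> 0 \<Longrightarrow> \<sigma> \<in> K \<and> card \<sigma> = n + 1"
  shows "c \<in> simplicial_chains K n"
  using assms by (auto simp: simplicial_chains_def finite_chain_def)

lemma simplicial_chainsD:
  "c \<in> simplicial_chains K n \<Longrightarrow> c \<sigma> \<noteq> 0 \<Longrightarrow> \<sigma> \<in> K \<and> finite \<sigma> \<and> card \<sigma> = n + 1"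
  by (auto simp: simplicial_chains_def)

text \<open>Chains of dimension \<open>n\<close> live on sets with \<open>n + 1\<close> vertices,
  never on \<open>{}\<close>. Complexes closed under all subsets can thus be compared with
  Vietoris-Rips complexes, which omit \<open>{}\<close>.\<close>

lemma simplicial_chains_mono:
  assumes "c \<in> simplicial_chains K n" "\<And>\<sigma>. \<sigma> \<in> K \<Longrightarrow> \<sigma> \<noteq> {} \<Longrightarrow> \<sigma> \<in> L"
  shows "c \<in> simplicial_chains L n"
  using assms by (fastforce simp: simplicial_chains_def)

lemma simplicial_chains_add:
  assumes "c \<in> simplicial_chains K n" "d \<in> simplicial_chains K n"
  shows "c + d \<in> simplicial_chains K n"
proof (rule simplicial_chainsI)
  show "finite_chain (c + d)"
    using assms[THEN simplicial_chains_finite_chain] by (rule finite_chain_add)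
  fix \<sigma> assume "(c + d) \<sigma> \<noteq> 0"
  then show "\<sigma> \<in> K \<and> card \<sigma> = n + 1"
    using add_nonzero[of c d \<sigma>] assms[THEN simplicial_chainsD, of \<sigma>] by blast
qed

lemma simplicial_chains_uminus:
  "c \<in> simplicial_chains K n \<Longrightarrow> - c \<in> simplicial_chains K n"
  by (simp add: simplicial_chains_def)

lemma simplicial_chains_cone:
  assumes "c \<in> simplicial_chains K n"
    and "\<And>\<sigma>. c \<sigma> \<noteq> 0 \<Longrightarrow> insert a \<sigma> \<in> L"
  shows "cone_chain a c \<in> simplicial_chains L (Suc n)"
proof (rule simplicial_chainsI)
  show "finite_chain (cone_chain a c)"
    using assms(1) by (intro finite_chain_cone simplicial_chains_finite_chain)
  fix \<sigma> assume "cone_chain a c \<sigma> \<noteq> 0"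
  then have a: "a \<in> \<sigma>" "c (\<sigma> - {a}) \<noteq> 0"
    using cone_nonzero[of a c \<sigma>] by simp_all
  then have "finite (\<sigma> - {a})" "card (\<sigma> - {a}) = n + 1"
    using simplicial_chainsD[OF assms(1) a(2)] by simp_all
  then show "\<sigma> \<in> L \<and> card \<sigma> = Suc n + 1"
    using a assms(2)[OF a(2)] by (simp add: insert_absorb)
qed

text \<open>At \<open>{}\<close> the augmentation sees only singletons, which a chain of dimension
  \<open>Suc n\<close> does not contain; this is where positive dimension enters. At other faces, a
  simplex \<open>\<sigma>\<close> and its removed vertex \<open>v\<close> are determined by
  \<open>v\<close>, as \<open>\<sigma> = insert v \<tau>\<close>.\<close>

lemma simplicial_boundary_eq_augmented:
  assumes c: "c \<in> simplicial_chains K (Suc n)"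
  shows "simplicial_boundary c = augmented_boundary c"
proof
  fix \<tau>
  show "simplicial_boundary c \<tau> = augmented_boundary c \<tau>"
  proof (cases "\<tau> = {}")
    case True
    have "c {v} = 0" for v
      using simplicial_chainsD[OF c, of "{v}"] by auto
    then show ?thesis
      using True by (simp add: simplicial_boundary_def augmented_boundary_def)
  next
    case False
    have fin: "finite {\<sigma>. c \<sigma> \<noteq> 0}" "\<And>\<sigma>. c \<sigma> \<noteq> 0 \<Longrightarrow> finite \<sigma>"
      using c by (auto simp: simplicial_chains_def)
    have "simplicial_boundary c \<tau> =
        (\<Sum>(\<sigma>, v)\<in>(SIGMA \<sigma>:{\<sigma>. c \<sigma> \<noteq> 0}. {v. v \<in> \<sigma> \<and> \<sigma> - {v} = \<tau>}). c \<sigma> * face_sign \<sigma> v)"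
      using False fin by (simp add: simplicial_boundary_def sum_distrib_left sum.Sigma)
    also have "\<dots> = (\<Sum>v | v \<notin> \<tau> \<and> c (insert v \<tau>) \<noteq> 0.
        face_sign (insert v \<tau>) v * c (insert v \<tau>))"
      by (rule sum.reindex_bij_witness[where j = snd and i = "\<lambda>v. (insert v \<tau>, v)"])
        (auto simp: insert_absorb mult.commute)
    finally show ?thesis
      by (simp add: augmented_boundary_def)
  qed
qed

section \<open>Boundaries as an additive group of chains\<close>

lemma boundaries_add:
  assumes "b \<in> boundaries K n" "b' \<in> boundaries K n" shows "b + b' \<in> boundaries K n"
proof -
  obtain c c' where c: "c \<in> simplicial_chains K (Suc n)" "c' \<in> simplicial_chains K (Suc n)"
    "b = simplicial_boundary c" "b' = simplicial_boundary c'"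
    using assms by (auto simp: boundaries_def)
  then have "b + b' = simplicial_boundary (c + c')"
    by (metis augmented_boundary_add simplicial_boundary_eq_augmented simplicial_chains_add
        simplicial_chains_finite_chain)
  then show ?thesis
    using simplicial_chains_add[OF c(1,2)] unfolding boundaries_def by (metis Suc_eq_plus1 imageI)
qed

lemma boundaries_uminus:
  assumes "b \<in> boundaries K n" shows "- b \<in> boundaries K n"
proof -
  obtain c where c: "c \<in> simplicial_chains K (Suc n)" "b = simplicial_boundary c"
    using assms by (auto simp: boundaries_def)
  then have "- b = simplicial_boundary (- c)"
    by (metis augmented_boundary_uminus simplicial_boundary_eq_augmented simplicial_chains_uminus)
  then show ?thesis
    using simplicial_chains_uminus[OF c(1)] unfolding boundaries_def by (metis Suc_eq_plus1 imageI)
qed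

lemma zero_in_boundaries: "0 \<in> boundaries K n"
proof -
  have "(0 :: 'a set \<Rightarrow> 'b) \<in> simplicial_chains K (n + 1)"
    by (simp add: simplicial_chains_def)
  moreover have "simplicial_boundary (0 :: 'a set \<Rightarrow> 'b) = 0"
    by (simp add: fun_eq_iff simplicial_boundary_def)
  ultimately show ?thesis
    unfolding boundaries_def by (metis imageI)
qed

lemma boundaries_mono:
  assumes "\<And>\<sigma>. \<sigma> \<in> K \<Longrightarrow> \<sigma> \<noteq> {} \<Longrightarrow> \<sigma> \<in> L"
  shows "boundaries K n \<subseteq> boundaries L n"
  unfolding boundaries_def
  by (intro image_mono subsetI, erule simplicial_chains_mono) (rule assms)

text \<open>The left side is the value of \<open>pm_map\<close> at the class of \<open>z\<close>,
  the right side the zero class: a class dies as soon as its representative bounds in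
  \<open>L\<close>.\<close>

lemma boundaries_coset:
  assumes "z \<in> boundaries L n" "K \<subseteq> L"
  shows "(z +o boundaries K n) + boundaries L n = boundaries L n"
proof
  show "(z +o boundaries K n) + boundaries L n \<subseteq> boundaries L n"
  proof
    fix c assume "c \<in> (z +o boundaries K n) + boundaries L n"
    then obtain b b' where "c = (z + b) + b'" "b \<in> boundaries K n" "b' \<in> boundaries L n"
      by (auto elim!: set_plus_elim simp: elt_set_plus_def)
    moreover have "boundaries K n \<subseteq> (boundaries L n :: ('a set \<Rightarrow> 'b) set)"
      using assms(2) by (intro boundaries_mono) blast
    ultimately show "c \<in> boundaries L n"
      using assms(1) boundaries_add by blast
  qed
  show "boundaries L n \<subseteq> (z +o boundaries K n) + boundaries L n"
  proof
    fix b :: "'a set \<Rightarrow> 'b" assume "b \<in> boundaries L n"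
    then have "- z + b \<in> boundaries L n"
      using assms(1) by (intro boundaries_add boundaries_uminus)
    moreover have "z + 0 \<in> z +o boundaries K n"
      using zero_in_boundaries by (rule set_plus_intro2)
    ultimately have "(z + 0) + (- z + b) \<in> (z +o boundaries K n) + boundaries L n"
      by (intro set_plus_intro)
    then show "b \<in> (z +o boundaries K n) + boundaries L n"
      by simp
  qed
qed


section \<open>Pushing cycles\<close>

text \<open>For a cycle the cone formula reduces to \<open>\<partial> (cone_chain a z) = z\<close>.
  Only simplices in the support of \<open>z\<close> are joined with \<open>a\<close>, so the
  condition concerns these alone.\<close>

lemma cone_cycle_in_boundaries:
  assumes z: "z \<in> simplicial_chains K (Suc n)" "augmented_boundary z = 0"
    and a: "\<And>\<sigma>. z \<sigma> \<noteq> 0 \<Longrightarrow> insert a \<sigma> \<in> L"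
  shows "z \<in> boundaries L (Suc n)"
proof -
  have "cone_chain a z \<in> simplicial_chains L (Suc (Suc n))"
    using z(1) a by (rule simplicial_chains_cone)
  moreover from this have "simplicial_boundary (cone_chain a z) = z"
    using z by (simp add: simplicial_boundary_eq_augmented augmented_boundary_cone
        simplicial_chains_finite_chain cone_zero)
  ultimately show ?thesis
    unfolding boundaries_def by (metis Suc_eq_plus1 imageI)
qed

text \<open>
  The cycle \<open>z - \<partial> (cone_chain a y)\<close>, where \<open>y\<close> is the part of \<open>z\<close> supported by the simplices containing
  \<open>x\<close>, avoids \<open>x\<close>: it equals \<open>(z - y) + cone_chain a (\<partial> y)\<close>, and \<open>\<partial> y = - \<partial> (z - y)\<close>.
\<close>

lemma push_vertex:
  assumes z: "z \<in> simplicial_chains K (Suc n)" "augmented_boundary z = 0"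
    and face: "\<And>\<sigma> \<tau>. \<sigma> \<in> K \<Longrightarrow> \<tau> \<subseteq> \<sigma> \<Longrightarrow> \<tau> \<in> K"
    and push: "\<And>\<sigma>. \<sigma> \<in> K \<Longrightarrow> x \<in> \<sigma> \<Longrightarrow> insert a \<sigma> \<in> K"
    and "a \<noteq> x"
  obtains z' where "z' \<in> simplicial_chains K (Suc n)" "augmented_boundary z' = 0"
    "z - z' \<in> boundaries K (Suc n)" "chain_vertices z' \<subseteq> insert a (chain_vertices z - {x})"
proof -
  define y where "y \<sigma> = (if x \<in> \<sigma> then z \<sigma> else 0)" for \<sigma>
  have zf: "finite_chain z"
    using z(1) by (rule simplicial_chains_finite_chain)
  have y: "y \<in> simplicial_chains K (Suc n)"
  proof (rule simplicial_chainsI[OF finite_chainI[OF finite_chain_vertices[OF zf]]])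
    fix \<sigma> assume "y \<sigma> \<noteq> 0"
    then have "z \<sigma> \<noteq> 0"
      by (simp add: y_def split: if_splits)
    then show "\<sigma> \<subseteq> chain_vertices z" "\<sigma> \<in> K \<and> card \<sigma> = Suc n + 1"
      using simplicial_chainsD[OF z(1), of \<sigma>] subset_chain_vertices[of z \<sigma>] by blast+
  qed
  then have yf: "finite_chain y"
    by (rule simplicial_chains_finite_chain)
  have w: "cone_chain a y \<in> simplicial_chains K (Suc (Suc n))"
    using y
  proof (rule simplicial_chains_cone)
    fix \<sigma> assume "y \<sigma> \<noteq> 0"
    then have "x \<in> \<sigma>" "z \<sigma> \<noteq> 0"
      by (simp_all add: y_def split: if_splits)
    then show "insert a \<sigma> \<in> K"
      using push simplicial_chainsD[OF z(1), of \<sigma>] by blast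
  qed
  define z' where "z' = z - augmented_boundary (cone_chain a y)"
  have z'_eq: "z' = (z - y) + cone_chain a (augmented_boundary y)"
    by (simp add: z'_def augmented_boundary_cone yf)
  have dy: "augmented_boundary y = - augmented_boundary (z - y)"
    by (simp add: augmented_boundary_diff zf yf z(2))
  \<comment> \<open>A simplex in the boundary of \<open>y\<close> is a facet of one containing
    \<open>x\<close>. By \<open>dy\<close> it is also a facet of one avoiding \<open>x\<close>, so
    it avoids \<open>x\<close> itself and the vertex \<open>v\<close> must be
    \<open>x\<close>.\<close>
  have dy_nonzero: "x \<notin> \<rho> \<and> (\<exists>v. v \<notin> \<rho> \<and> x \<in> insert v \<rho> \<and> z (insert v \<rho>) \<noteq> 0)"
    if "augmented_boundary y \<rho> \<noteq> 0" for \<rho>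
  proof
    have "augmented_boundary (z - y) \<rho> \<noteq> 0"
      using that by (simp add: dy)
    then obtain v where "(z - y) (insert v \<rho>) \<noteq> 0"
      by (rule augmented_boundary_nonzero)
    then show "x \<notin> \<rho>"
      by (auto simp: y_def)
    show "\<exists>v. v \<notin> \<rho> \<and> x \<in> insert v \<rho> \<and> z (insert v \<rho>) \<noteq> 0"
      using that by (rule augmented_boundary_nonzero) (auto simp: y_def split: if_splits)
  qed
  have z'_nonzero: "(x \<notin> \<sigma> \<and> z \<sigma> \<noteq> 0) \<or>
      (\<exists>\<rho>. a \<notin> \<rho> \<and> x \<notin> \<rho> \<and> \<sigma> = insert a \<rho> \<and> z (insert x \<rho>) \<noteq> 0)"
    if nz: "z' \<sigma> \<noteq> 0" for \<sigma>
  proof (cases "cone_chain a (augmented_boundary y) \<sigma> = 0")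
    case True
    then show ?thesis
      using nz by (auto simp: z'_eq y_def split: if_splits)
  next
    case False
    then have "a \<in> \<sigma>" "augmented_boundary y (\<sigma> - {a}) \<noteq> 0"
      using cone_nonzero[of a "augmented_boundary y" \<sigma>] by simp_all
    then show ?thesis
      using dy_nonzero[of "\<sigma> - {a}"] by (metis insertE insert_Diff Diff_iff singletonI)
  qed
  have "z' \<in> simplicial_chains K (Suc n)"
  proof (rule simplicial_chainsI)
    show "finite_chain z'"
      by (simp add: z'_def finite_chain_diff finite_chain_augmented_boundary finite_chain_cone zf yf)
    fix \<sigma> assume "z' \<sigma> \<noteq> 0"
    then show "\<sigma> \<in> K \<and> card \<sigma> = Suc n + 1"
    proof (rule z'_nonzero[THEN disjE])
      assume "x \<notin> \<sigma> \<and> z \<sigma> \<noteq> 0"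
      then show ?thesis
        using simplicial_chainsD[OF z(1)] by auto
    next
      assume "\<exists>\<rho>. a \<notin> \<rho> \<and> x \<notin> \<rho> \<and> \<sigma> = insert a \<rho> \<and> z (insert x \<rho>) \<noteq> 0"
      then obtain \<rho> where \<rho>: "a \<notin> \<rho>" "x \<notin> \<rho>" "\<sigma> = insert a \<rho>" "z (insert x \<rho>) \<noteq> 0"
        by blast
      have K: "insert x \<rho> \<in> K" "finite (insert x \<rho>)" "card (insert x \<rho>) = Suc n + 1"
        using simplicial_chainsD[OF z(1) \<rho>(4)] by auto
      \<comment> \<open>\<open>\<sigma>\<close> is the face opposite \<open>x\<close> of
        \<open>insert a (insert x \<rho>)\<close>, a simplex by \<open>push\<close>.\<close>
      have "\<sigma> \<in> K"
        using push[OF K(1)] \<rho> by (blast intro: face)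
      then show ?thesis
        using K \<rho> by simp
    qed
  qed
  moreover have "augmented_boundary z' = 0"
    by (simp add: z'_def augmented_boundary_diff augmented_boundary_boundary zf yf z(2)
        finite_chain_cone finite_chain_augmented_boundary)
  moreover have "z - z' \<in> boundaries K (Suc n)"
    unfolding z'_def boundaries_def using w simplicial_boundary_eq_augmented[OF w] by force
  moreover have "chain_vertices z' \<subseteq> insert a (chain_vertices z - {x})"
  proof
    fix v assume "v \<in> chain_vertices z'"
    then obtain \<sigma> where "v \<in> \<sigma>" "z' \<sigma> \<noteq> 0"
      by (auto simp: chain_vertices_def)
    then show "v \<in> insert a (chain_vertices z - {x})"
      using z'_nonzero[of \<sigma>] by (auto simp: chain_vertices_def)
  qed
  ultimately show thesis
    by (rule that)
qed

text \<open>Induction on the number of vertices outside \<open>A\<close>: a push from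
  \<open>x\<close> to \<open>f x\<close> removes \<open>x\<close> and can add only a vertex of
  \<open>A\<close>. Once all vertices lie in \<open>A\<close>, the cycle is coned off from any point
  of \<open>A\<close>.\<close>

lemma cycle_in_boundaries_push:
  assumes z: "z \<in> simplicial_chains K (Suc n)" "augmented_boundary z = 0"
    and face: "\<And>\<sigma> \<tau>. \<sigma> \<in> K \<Longrightarrow> \<tau> \<subseteq> \<sigma> \<Longrightarrow> \<tau> \<in> K"
    and push: "\<And>\<sigma> x. \<sigma> \<in> K \<Longrightarrow> x \<in> \<sigma> \<Longrightarrow> x \<notin> A \<Longrightarrow> f x \<in> A \<and> insert (f x) \<sigma> \<in> K"
    and A: "A \<noteq> {}" "Pow A \<subseteq> K"
  shows "z \<in> boundaries K (Suc n)"
  using z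
proof (induction "card (chain_vertices z - A)" arbitrary: z rule: less_induct)
  case less
  show ?case
  proof (cases "chain_vertices z \<subseteq> A")
    case True
    obtain a where "a \<in> A"
      using A by blast
    then have "insert a \<sigma> \<in> K" if "z \<sigma> \<noteq> 0" for \<sigma>
      using subset_chain_vertices[of z \<sigma>] that True A(2) by blast
    then show ?thesis
      by (rule cone_cycle_in_boundaries[OF less.prems])
  next
    case False
    then obtain x \<sigma> where x: "x \<notin> A" "x \<in> \<sigma>" "z \<sigma> \<noteq> 0" "x \<in> chain_vertices z"
      by (auto simp: chain_vertices_def)
    then have "\<sigma> \<in> K"
      using simplicial_chainsD[OF less.prems(1) x(3)] by simp
    then have fx: "f x \<in> A"
      using x push by blast
    then have "f x \<noteq> x"
      using x by metis
    then obtain z' where z': "z' \<in> simplicial_chains K (Suc n)" "augmented_boundary z' = 0"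
      "z - z' \<in> boundaries K (Suc n)" "chain_vertices z' \<subseteq> insert (f x) (chain_vertices z - {x})"
      using push_vertex[OF less.prems, of x "f x"] face push x(1) by metis
    have "chain_vertices z' - A \<subset> chain_vertices z - A"
      using z'(4) fx x by auto
    moreover have "finite (chain_vertices z - A)"
      using finite_chain_vertices[OF simplicial_chains_finite_chain[OF less.prems(1)]] by simp
    ultimately have "z' \<in> boundaries K (Suc n)"
      using z'(1,2) less.hyps psubset_card_mono by blast
    then have "(z - z') + z' \<in> boundaries K (Suc n)"
      using z'(3) by (intro boundaries_add)
    then show ?thesis
      by simp
  qed
qed


section \<open>Vietoris--Rips complexes\<close>

text \<open>A finite nonempty set attains its diameter, so strictness survives the supremum.\<close>

lemma diameter_finite_less_iff:
  fixes S :: "'a::metric_space set"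
  assumes "finite S" "S \<noteq> {}"
  shows "diameter S < r \<longleftrightarrow> (\<forall>x\<in>S. \<forall>y\<in>S. dist x y < r)"
proof
  assume "diameter S < r"
  then show "\<forall>x\<in>S. \<forall>y\<in>S. dist x y < r"
    using diameter_bounded_bound[OF finite_imp_bounded[OF assms(1)]] by fastforce
next
  assume "\<forall>x\<in>S. \<forall>y\<in>S. dist x y < r"
  moreover have "compact S"
    using assms(1) by (rule finite_imp_compact)
  then obtain x y where "x \<in> S" "y \<in> S" "dist x y = diameter S"
    using diameter_compact_attained assms(2) by blast
  ultimately show "diameter S < r"
    by metis
qed

lemma vietoris_rips_iff:
  "\<sigma> \<in> vietoris_rips X r \<longleftrightarrow>
    \<sigma> \<noteq> {} \<and> finite \<sigma> \<and> \<sigma> \<subseteq> X \<and> (\<forall>x\<in>\<sigma>. \<forall>y\<in>\<sigma>. dist x y < r)"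
  unfolding vietoris_rips_def using diameter_finite_less_iff by blast

lemma vietoris_rips_mono: "r \<le> s \<Longrightarrow> vietoris_rips X r \<subseteq> vietoris_rips X s"
  by (auto simp: vietoris_rips_def)

lemma cycles_augmented:
  assumes "z \<in> cycles K (Suc n)"
  shows "z \<in> simplicial_chains K (Suc n)" "augmented_boundary z = 0"
  using assms simplicial_boundary_eq_augmented[of z K n] by (simp_all add: cycles_def)

lemma vietoris_rips_cycles_bound:
  fixes X :: "'a::metric_space set"
  assumes z: "z \<in> cycles (vietoris_rips X s) (Suc n)"
    and A: "A \<subseteq> X" "A \<noteq> {}" "finite A" "diameter A < r" "\<And>x. x \<in> X \<Longrightarrow> infdist x A < r"
    and s: "0 < s" and t: "s + r \<le> t"
  shows "z \<in> boundaries (vietoris_rips X t) (Suc n)"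
proof -
  have "\<exists>a\<in>A. dist x a < r \<and> (x \<in> A \<longrightarrow> a = x)" if "x \<in> X" for x
  proof (cases "x \<in> A")
    case True
    moreover have "0 < r"
      using A(5)[OF that] infdist_nonneg[of x A] by linarith
    ultimately show ?thesis
      by auto
  next
    case False
    then show ?thesis
      using A(5)[OF that] A(2) cInf_lessD[of "dist x ` A" r] by (auto simp: infdist_notempty)
  qed
  then obtain f where f: "\<And>x. x \<in> X \<Longrightarrow> f x \<in> A \<and> dist x (f x) < r \<and> (x \<in> A \<longrightarrow> f x = x)"
    by metis
  have dA: "dist a b < r" if "a \<in> A" "b \<in> A" for a b
    using A(2,3,4) that diameter_finite_less_iff by blast
  \<comment> \<open>The complex at scale \<open>t\<close> need not admit the insertion of
    \<open>f x\<close> into each of its simplices. \<open>K\<close> admits it repeatedly, because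
    the images under \<open>f\<close> of all vertices of \<open>\<sigma>\<close> are included
    beforehand.\<close>
  define K where "K = Pow A \<union> {\<tau>. \<exists>\<sigma>\<in>vietoris_rips X s. \<tau> \<subseteq> \<sigma> \<union> f ` \<sigma>}"
  have K_vr: "\<tau> \<in> vietoris_rips X t" if \<tau>: "\<tau> \<in> K" "\<tau> \<noteq> {}" for \<tau>
  proof -
    consider "\<tau> \<subseteq> A" | \<sigma> where "\<sigma> \<in> vietoris_rips X s" "\<tau> \<subseteq> \<sigma> \<union> f ` \<sigma>"
      using \<tau>(1) unfolding K_def by blast
    then show ?thesis
    proof cases
      case 1
      have "dist a b < t" if "a \<in> \<tau>" "b \<in> \<tau>" for a b
        using dA[of a b] that 1 s t by fastforce
      then show ?thesis
        using 1 A \<tau>(2) by (auto simp: vietoris_rips_iff intro: finite_subset)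
    next
      case 2
      then have \<sigma>: "finite \<sigma>" "\<sigma> \<subseteq> X" "\<And>x y. x \<in> \<sigma> \<Longrightarrow> y \<in> \<sigma> \<Longrightarrow> dist x y < s"
        by (auto simp: vietoris_rips_iff)
      \<comment> \<open>Only these mixed distances, estimated through \<open>y\<close>, call for the
        full sum \<open>s + r\<close>; the others are below \<open>s\<close> or below
        \<open>r\<close>.\<close>
      have xfy: "dist x (f y) < t" if "x \<in> \<sigma>" "y \<in> \<sigma>" for x y
        using dist_triangle[of x "f y" y] \<sigma>(3)[OF that] f[of y] \<sigma>(2) that t by fastforce
      have ff: "dist (f x) (f y) < t" if "x \<in> \<sigma>" "y \<in> \<sigma>" for x y
        using dA[of "f x" "f y"] f \<sigma>(2) that s t by fastforce
      have xy: "dist x y < t" if "x \<in> \<sigma>" "y \<in> \<sigma>" for x y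
      proof -
        have "dist y (f y) < r"
          using f \<sigma>(2) that by blast
        then show ?thesis
          using \<sigma>(3)[OF that] t zero_le_dist[of y "f y"] by linarith
      qed
      have "dist a b < t" if "a \<in> \<sigma> \<union> f ` \<sigma>" "b \<in> \<sigma> \<union> f ` \<sigma>" for a b
        using that xfy ff xy by (auto simp: dist_commute)
      moreover have "\<tau> \<subseteq> X"
        using 2 \<sigma>(2) f A(1) by blast
      moreover have "finite \<tau>"
        using 2 \<sigma>(1) by (meson finite_UnI finite_imageI finite_subset)
      ultimately show ?thesis
        using 2 \<tau>(2) by (auto simp: vietoris_rips_iff subset_iff)
    qed
  qed
  have "z \<in> boundaries K (Suc n)"
  proof (rule cycle_in_boundaries_push[where A = A and f = f])
    show "z \<in> simplicial_chains K (Suc n)" "augmented_boundary z = 0"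
      using cycles_augmented[OF z] by (auto intro: simplicial_chains_mono simp: K_def)
    show "\<tau> \<in> K" if "\<sigma> \<in> K" "\<tau> \<subseteq> \<sigma>" for \<sigma> \<tau>
      using that unfolding K_def by blast
    show "f x \<in> A \<and> insert (f x) \<sigma> \<in> K" if \<sigma>: "\<sigma> \<in> K" "x \<in> \<sigma>" "x \<notin> A" for \<sigma> x
    proof -
      \<comment> \<open>The vertex \<open>x\<close> outside \<open>A\<close> excludes
        \<open>\<sigma> \<subseteq> A\<close>. Since \<open>f\<close> maps \<open>\<rho>\<close>
        into \<open>A\<close>, \<open>x\<close> is a vertex of \<open>\<rho>\<close> itself, and
        \<open>f x\<close> is among the vertices already allowed.\<close>
      obtain \<rho> where \<rho>: "\<rho> \<in> vietoris_rips X s" "\<sigma> \<subseteq> \<rho> \<union> f ` \<rho>"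
        using \<sigma> unfolding K_def by blast
      then have "\<rho> \<subseteq> X"
        by (simp add: vietoris_rips_iff)
      then have "x \<in> \<rho>"
        using \<sigma> \<rho> f by blast
      then show ?thesis
        using \<rho> f \<open>\<rho> \<subseteq> X\<close> unfolding K_def by blast
    qed
  qed (use A K_def in auto)
  then show ?thesis
    using boundaries_mono[of K "vietoris_rips X t"] K_vr by blast
qed

text \<open>A simplex joined with \<open>a\<close> keeps its diameter below \<open>t\<close>, so the
  complex is a cone and the cycle bounds at the same scale.\<close>

lemma vietoris_rips_cycles_bound_center:
  fixes X :: "'a::metric_space set"
  assumes z: "z \<in> cycles (vietoris_rips X t) (Suc n)"
    and a: "a \<in> X" "\<And>x. x \<in> X \<Longrightarrow> dist x a < t"
  shows "z \<in> boundaries (vietoris_rips X t) (Suc n)"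
proof (rule cone_cycle_in_boundaries[OF cycles_augmented[OF z]])
  fix \<sigma> assume "z \<sigma> \<noteq> 0"
  then have "\<sigma> \<in> vietoris_rips X t"
    using simplicial_chainsD[OF cycles_augmented(1)[OF z], of \<sigma>] by simp
  \<comment> \<open>The instance \<open>x = a\<close> supplies \<open>0 < t\<close>, for the
    distance of \<open>a\<close> to itself.\<close>
  then show "insert a \<sigma> \<in> vietoris_rips X t"
    using a a(2)[OF a(1)] by (auto simp: vietoris_rips_iff dist_commute subset_iff)
qed


section \<open>Bars\<close>

text \<open>If all cycles bound, the map from \<open>s\<close> to \<open>t\<close> is constant, and
  so is that of the direct sum. But on summand \<open>j\<close> it is the identity of the field,
  which separates 0 and 1. Transporting constancy rather than vanishing takes only bijectivity and
  naturality of the isomorphism.\<close>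

lemma barcode_not_cycles_bound:
  assumes "is_barcode (persistent_homology K n :: ('f::field, ('a set \<Rightarrow> 'f) set) pers_module) J I"
    and "j \<in> J" and s: "s \<in> I j" and t: "t \<in> I j" "s \<le> t" and KL: "K s \<subseteq> K t"
  shows "\<not> (cycles (K s) n :: ('a set \<Rightarrow> 'f) set) \<subseteq> boundaries (K t) n"
proof
  assume bound: "(cycles (K s) n :: ('a set \<Rightarrow> 'f) set) \<subseteq> boundaries (K t) n"
  let ?V = "persistent_homology K n :: ('f, ('a set \<Rightarrow> 'f) set) pers_module"
  let ?W = "direct_sum_module J (\<lambda>j. interval_module (I j) :: ('f, 'f) pers_module)"
  obtain \<phi> where \<phi>: "\<And>r. r > 0 \<Longrightarrow> bij_betw (\<phi> r) (pm_carrier ?V r) (pm_carrier ?W r)"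
    "\<And>r s x. r > 0 \<Longrightarrow> r \<le> s \<Longrightarrow> x \<in> pm_carrier ?V r \<Longrightarrow>
      \<phi> s (pm_map ?V r s x) = pm_map ?W r s (\<phi> r x)"
    using assms(1) unfolding is_barcode_def pm_isomorphic_def by blast
  have "s > 0"
    using assms(1,2) s unfolding is_barcode_def by blast
  have map_const: "pm_map ?V s t C = boundaries (K t) n" if "C \<in> pm_carrier ?V s" for C
    using that bound boundaries_coset[OF _ KL] by (auto simp: persistent_homology_def)
  have same: "pm_map ?W s t x = pm_map ?W s t y"
    if "x \<in> pm_carrier ?W s" "y \<in> pm_carrier ?W s" for x y
    using that \<phi>(1)[OF \<open>s > 0\<close>] \<phi>(2)[OF \<open>s > 0\<close> \<open>s \<le> t\<close>] map_const
    unfolding bij_betw_def by (metis (no_types, lifting) imageE)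
  have "(\<lambda>i\<in>J. if i = j then c else 0) \<in> pm_carrier ?W s" for c :: 'f
    using s \<open>j \<in> J\<close> by (auto simp: direct_sum_module_def interval_module_def)
  from this[of 0] this[of 1] have "pm_map ?W s t (\<lambda>i\<in>J. if i = j then 0 else 0) j
      = pm_map ?W s t (\<lambda>i\<in>J. if i = j then 1 else 0) j"
    by (intro fun_cong[OF same])
  then show False
    using s t \<open>j \<in> J\<close> by (simp add: direct_sum_module_def interval_module_def)
qed

text \<open>Nonemptiness and positivity make the infimum a real number, so the difference in
  \<open>ereal\<close> is a genuine one; each \<open>x - r\<close> with \<open>x\<close> in
  \<open>S\<close> is a lower bound of \<open>S\<close>.\<close>

lemma interval_length_le:
  assumes "S \<noteq> {}" "S \<subseteq> {0<..}" and gap: "\<And>x y. x \<in> S \<Longrightarrow> y \<in> S \<Longrightarrow> x \<le> y + r"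
  shows "interval_length S \<le> ereal r"
proof -
  obtain x0 where x0: "x0 \<in> S"
    using assms(1) by blast
  have "(INF x\<in>S. ereal x) \<le> ereal x0"
    using x0 by (rule INF_lower)
  moreover have "0 \<le> (INF x\<in>S. ereal x)"
    using assms(2) by (intro INF_greatest) force
  ultimately obtain m where m: "(INF x\<in>S. ereal x) = ereal m"
    by (cases "INF x\<in>S. ereal x") auto
  have "ereal x \<le> ereal (m + r)" if "x \<in> S" for x
  proof -
    have "ereal (x - r) \<le> (INF y\<in>S. ereal y)"
      using gap[OF that] by (intro INF_greatest) (auto simp: algebra_simps)
    then show ?thesis
      by (simp add: m)
  qed
  then have "(SUP x\<in>S. ereal x) \<le> ereal (m + r)"
    by (intro SUP_least)
  then show ?thesis
    unfolding interval_length_def m by (cases "SUP x\<in>S. ereal x") auto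
qed

theorem proposition9p1:
  fixes X :: "'a::metric_space set" and k :: nat
    and J :: "'j set" and I :: "'j \<Rightarrow> real set" and j :: 'j
  assumes "compact X"
    and "k \<ge> 1"
    and "is_barcode (vr_homology X k :: ('f::field, ('a set \<Rightarrow> 'f) set) pers_module) J I"
    and "j \<in> J"
  shows "interval_length (I j) \<le> spread X \<and>
    (\<forall>u v. 0 < u \<and> u < v \<and> I j = {u<..v} \<longrightarrow> ereal v \<le> spread_le 1 X)"
proof -
  obtain n where k: "k = Suc n"
    using \<open>k \<ge> 1\<close> by (cases k) auto
  have I: "I j \<noteq> {}" "I j \<subseteq> {0<..}"
    using assms(3,4) by (auto simp: is_barcode_def)
  have alive: "\<not> (cycles (vietoris_rips X s) (Suc n) :: ('a set \<Rightarrow> 'f) set)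
      \<subseteq> boundaries (vietoris_rips X t) (Suc n)" if "s \<in> I j" "t \<in> I j" "s \<le> t" for s t
    using assms(3,4) that vietoris_rips_mono[OF that(3)] unfolding vr_homology_def k
    by (intro barcode_not_cycles_bound)
  have infdist_less: "infdist x A < r"
    if "(SUP x\<in>X. ereal (infdist x A)) < ereal r" "x \<in> X" for x r and A :: "'a set"
    using that SUP_upper[of x X "\<lambda>x. ereal (infdist x A)"]
    by (metis less_ereal.simps(1) order_le_less_trans)
  have "interval_length (I j) \<le> ereal r"
    if A: "A \<subseteq> X" "A \<noteq> {}" "finite A" "diameter A < r"
      "(SUP x\<in>X. ereal (infdist x A)) < ereal r" and r: "0 < r" for r A
  proof (rule interval_length_le[OF I])
    fix t s assume ts: "t \<in> I j" "s \<in> I j"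
    show "t \<le> s + r"
    proof (rule ccontr)
      assume "\<not> t \<le> s + r"
      \<comment> \<open>The bar would contain two scales more than \<open>r\<close> apart, yet
        everything at \<open>s\<close> dies by \<open>s + r\<close>.\<close>
      then have "cycles (vietoris_rips X s) (Suc n)
          \<subseteq> (boundaries (vietoris_rips X t) (Suc n) :: ('a set \<Rightarrow> 'f) set)"
        using vietoris_rips_cycles_bound[OF _ A(1-4) infdist_less[OF A(5)]] ts I by fastforce
      then show False
        using alive[of s t] ts r \<open>\<not> t \<le> s + r\<close> by simp
    qed
  qed
  \<comment> \<open>The estimate holds for finite \<open>A\<close> of every cardinality, hence for
    the infima over \<open>r\<close> and then over \<open>N\<close>.\<close>
  then have "interval_length (I j) \<le> spread X"
    unfolding spread_def spread_le_def by (intro INF_greatest Inf_greatest) auto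
  moreover have "ereal v \<le> spread_le 1 X" if uv: "u < v" "I j = {u<..v}" for u v
    unfolding spread_le_def
  proof (rule Inf_greatest)
    fix e assume "e \<in> ereal ` {r. 0 < r \<and> (\<exists>A. A \<subseteq> X \<and> A \<noteq> {} \<and> finite A \<and> card A \<le> 1 \<and>
      diameter A < r \<and> (SUP x\<in>X. ereal (infdist x A)) < ereal r)}"
    then obtain r A where e: "e = ereal r" and A: "A \<subseteq> X" "A \<noteq> {}" "finite A" "card A \<le> 1"
      "(SUP x\<in>X. ereal (infdist x A)) < ereal r"
      by auto
    then have "card A = 1"
      by (metis One_nat_def card_gt_0_iff Suc_leI le_antisym)
    then obtain a where a: "A = {a}"
      using card_1_singletonE by blast
    \<comment> \<open>The right endpoint belongs to the bar, so \<open>alive\<close> applies with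
      both scales equal to \<open>v\<close>. If \<open>r < v\<close>, all of \<open>X\<close> lies
      within \<open>v\<close> of \<open>a\<close> and the complex at scale \<open>v\<close> is a
      cone.\<close>
    have "v \<le> r"
    proof (rule ccontr)
      assume "\<not> v \<le> r"
      then have "dist x a < v" if "x \<in> X" for x
        using infdist_less[OF A(5) that] by (simp add: a)
      then have "cycles (vietoris_rips X v) (Suc n)
          \<subseteq> (boundaries (vietoris_rips X v) (Suc n) :: ('a set \<Rightarrow> 'f) set)"
        using vietoris_rips_cycles_bound_center[of _ X v n a] A(1) a by blast
      then show False
        using alive[of v v] uv by simp
    qed
    then show "ereal v \<le> e"
      by (simp add: e)
  qed
  ultimately show ?thesis
    by blast
qed

end
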